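(* Suppose that $M$ is a connected manifold, that $u_1, u_2: M \to N$ are smooth maps, and that $u_2 = u_1 \circ f$ for some diffeomorphism $f: M \to M$. Then the forgetful functors $\mathbf{CRSE}(u_1,u_2) \to \mathbf{Const}(u_1)$ and $\mathbf{CRSE}(u_1,u_2) \to \mathbf{Const}(u_2)$ are surjective on objects (but not necessarily on morphisms).
   Context: Manifolds are smooth manifolds. A smooth map has constant rank if its Jacobian has the same rank at every point of the domain. A constant rank factorization of a smooth map $u: M \to N$ is a factorization $u = U \circ \phi$, where $\phi: M \to C$ is a smooth map of constant rank into a manifold $C$ (the phase space) and $U: C \to N$ is smooth; it is written $(\phi, U)$. The category $\mathbf{Const}(u)$ has the constant rank factorizations of $u$ as objects; a morphism $(\phi_1,U_1) \to (\phi_2,U_2)$, with phase spaces $C_1, C_2$, is a smooth map $c: C_1 \to C_2$ such that $\phi_2 = c \circ \phi_1$ and $U_1 = U_2 \circ c$. For smooth maps $u_1: M_1 \to N$, $u_2: M_2 \to N$, the category $\mathbf{CRSE}(u_1,u_2)$ has as objects the triples $(\phi_1,\phi_2,U)$ where $\phi_1: M_1 \to C$ and $\phi_2: M_2 \to C$ are smooth constant rank maps into a common manifold $C$ and $U: C \to N$ is smooth with $u_1 = U \circ \phi_1$ and $u_2 = U \circ \phi_2$; a morphism $(\phi_1,\phi_2,U) \to (\phi_1',\phi_2',U')$ is a smooth map $c: C \to C'$ with $\phi_1' = c \circ \phi_1$, $\phi_2' = c \circ \phi_2$ and $U = U' \circ c$. The forgetful functor $\mathbf{CRSE}(u_1,u_2)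 \to \mathbf{Const}(u_k)$ ($k=1,2$) sends $(\phi_1,\phi_2,U)$ to $(\phi_k, U)$ and a morphism $c$ to $c$. *)

theory Defs
  imports "HOL-Analysis.Analysis" "Jordan_Normal_Form.DL_Rank"
begin

section \<open>Smooth maps between open subsets of Euclidean spaces\<close>

text \<open>
  As in the library constant \<^const>\<open>Euclidean_space\<close>, the points of n-dimensional Euclidean space
  are the sequences \<open>x :: nat \<Rightarrow> real\<close> with \<open>x i = 0\<close> for all \<open>i \<ge> n\<close>. The dimension is a value,
  so manifolds of all dimensions (0 included) over a point type form one type.
\<close>

definition partial_deriv :: "nat \<Rightarrow> ((nat \<Rightarrow> real) \<Rightarrow> real) \<Rightarrow> (nat \<Rightarrow> real) \<Rightarrow> real" where
  "partial_deriv i g x = deriv (\<lambda>t. g (x(i := t))) (x i)"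

text \<open>
  \<open>C_k n W k g\<close>: the function \<open>g\<close> is of class \<open>C^k\<close> on the open subset \<open>W\<close> of n-space, that is, its
  iterated partial derivatives of all orders up to \<open>k\<close> exist and are continuous on \<open>W\<close>.
\<close>

primrec C_k :: "nat \<Rightarrow> (nat \<Rightarrow> real) set \<Rightarrow> nat \<Rightarrow> ((nat \<Rightarrow> real) \<Rightarrow> real) \<Rightarrow> bool" where
  "C_k n W 0 g \<longleftrightarrow> continuous_map (subtopology (Euclidean_space n) W) euclideanreal g"
| "C_k n W (Suc k) g \<longleftrightarrow>
     continuous_map (subtopology (Euclidean_space n) W) euclideanreal g \<and>
     (\<forall>i<n. (\<forall>x\<in>W. (\<lambda>t. g (x(i := t))) differentiable at (x i)) \<and>
            C_k n W k (partial_deriv i g))"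

definition smooth_euclid ::
    "nat \<Rightarrow> nat \<Rightarrow> (nat \<Rightarrow> real) set \<Rightarrow> ((nat \<Rightarrow> real) \<Rightarrow> nat \<Rightarrow> real) \<Rightarrow> bool" where
  "smooth_euclid n m W G \<longleftrightarrow> (\<forall>j<m. \<forall>k. C_k n W k (\<lambda>x. G x j))"

definition jacobian ::
    "nat \<Rightarrow> nat \<Rightarrow> ((nat \<Rightarrow> real) \<Rightarrow> nat \<Rightarrow> real) \<Rightarrow> (nat \<Rightarrow> real) \<Rightarrow> real mat" where
  "jacobian n m G x = Matrix.mat m n (\<lambda>(i, j). partial_deriv j (\<lambda>y. G y i) x)"


section \<open>Smooth manifolds\<close>

text \<open>A chart is a pair of its domain and its coordinate map (extensional, so that charts are equal
  iff they agree on their common domain).\<close>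

type_synonym 'a chart = "'a set \<times> ('a \<Rightarrow> nat \<Rightarrow> real)"

record 'a mfd =
  mtop :: "'a topology"
  mdim :: nat
  atlas :: "'a chart set"

abbreviation pts :: "'a mfd \<Rightarrow> 'a set" where
  "pts M \<equiv> topspace (mtop M)"

definition is_chart :: "'a topology \<Rightarrow> nat \<Rightarrow> 'a chart \<Rightarrow> bool" where
  "is_chart X n = (\<lambda>(D, \<phi>).
     openin X D \<and> \<phi> \<in> extensional D \<and> openin (Euclidean_space n) (\<phi> ` D) \<and>
     homeomorphic_map (subtopology X D) (subtopology (Euclidean_space n) (\<phi> ` D)) \<phi>)"

definition compatible :: "nat \<Rightarrow> 'a chart \<Rightarrow> 'a chart \<Rightarrow> bool" where
  "compatible n = (\<lambda>(D, \<phi>) (E, \<psi>).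
     smooth_euclid n n (\<phi> ` (D \<inter> E)) (\<lambda>x. \<psi> (inv_into D \<phi> x)) \<and>
     smooth_euclid n n (\<psi> ` (D \<inter> E)) (\<lambda>y. \<phi> (inv_into E \<psi> y)))"

text \<open>The smooth structure is a maximal atlas.\<close>

definition smooth_manifold :: "'a mfd \<Rightarrow> bool" where
  "smooth_manifold M \<longleftrightarrow>
     Hausdorff_space (mtop M) \<and> second_countable (mtop M) \<and>
     (\<forall>c\<in>atlas M. is_chart (mtop M) (mdim M) c) \<and>
     (\<Union>(fst ` atlas M)) = pts M \<and>
     (\<forall>c\<in>atlas M. \<forall>d\<in>atlas M. compatible (mdim M) c d) \<and>
     (\<forall>c. is_chart (mtop M) (mdim M) c \<and> (\<forall>d\<in>atlas M. compatible (mdim M) c d)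
          \<longrightarrow> c \<in> atlas M)"

definition local_rep ::
    "'a chart \<Rightarrow> 'b chart \<Rightarrow> ('a \<Rightarrow> 'b) \<Rightarrow> (nat \<Rightarrow> real) \<Rightarrow> nat \<Rightarrow> real" where
  "local_rep = (\<lambda>(D, \<phi>) (E, \<psi>) F x. \<psi> (F (inv_into D \<phi> x)))"

text \<open>Maps between manifolds are extensional functions, so that equality of maps is equality on the
  points of the domain, and composition is \<^const>\<open>compose\<close>.\<close>

definition smooth_map :: "'a mfd \<Rightarrow> 'b mfd \<Rightarrow> ('a \<Rightarrow> 'b) \<Rightarrow> bool" where
  "smooth_map M N F \<longleftrightarrow>
     F \<in> pts M \<rightarrow>\<^sub>E pts N \<and> continuous_map (mtop M) (mtop N) F \<and>
     (\<forall>(D, \<phi>)\<in>atlas M. \<forall>(E, \<psi>)\<in>atlas N.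
        smooth_euclid (mdim M) (mdim N) (\<phi> ` {p \<in> D. F p \<in> E}) (local_rep (D, \<phi>) (E, \<psi>) F))"

definition constant_rank :: "'a mfd \<Rightarrow> 'b mfd \<Rightarrow> ('a \<Rightarrow> 'b) \<Rightarrow> bool" where
  "constant_rank M N F \<longleftrightarrow>
     (\<exists>r. \<forall>p\<in>pts M. \<forall>(D, \<phi>)\<in>atlas M. \<forall>(E, \<psi>)\<in>atlas N. p \<in> D \<and> F p \<in> E \<longrightarrow>
        vec_space.rank (mdim N)
          (jacobian (mdim M) (mdim N) (local_rep (D, \<phi>) (E, \<psi>) F) (\<phi> p)) = r)"

definition diffeomorphism :: "'a mfd \<Rightarrow> 'b mfd \<Rightarrow> ('a \<Rightarrow> 'b) \<Rightarrow> bool" where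
  "diffeomorphism M N f \<longleftrightarrow>
     smooth_map M N f \<and> bij_betw f (pts M) (pts N) \<and>
     smooth_map N M (restrict (inv_into (pts M) f) (pts N))"


section \<open>Categories and functors\<close>

text \<open>\<open>Comp\<close> takes its arguments in the order of function composition; its first argument is the
  domain of the composite.\<close>

record ('o, 'h) category =
  Obj :: "'o set"
  Hom :: "'o \<Rightarrow> 'o \<Rightarrow> 'h set"
  Id :: "'o \<Rightarrow> 'h"
  Comp :: "'o \<Rightarrow> 'h \<Rightarrow> 'h \<Rightarrow> 'h"

record ('o, 'h, 'p, 'k) func =
  src :: "('o, 'h) category"
  tgt :: "('p, 'k) category"
  on_obj :: "'o \<Rightarrow> 'p"
  on_hom :: "'o \<Rightarrow> 'o \<Rightarrow> 'h \<Rightarrow> 'k"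

definition functorial :: "('o, 'h, 'p, 'k) func \<Rightarrow> bool" where
  "functorial F \<longleftrightarrow>
     (\<forall>X\<in>Obj (src F). on_obj F X \<in> Obj (tgt F) \<and>
        on_hom F X X (Id (src F) X) = Id (tgt F) (on_obj F X)) \<and>
     (\<forall>X\<in>Obj (src F). \<forall>Y\<in>Obj (src F). \<forall>g\<in>Hom (src F) X Y.
        on_hom F X Y g \<in> Hom (tgt F) (on_obj F X) (on_obj F Y)) \<and>
     (\<forall>X\<in>Obj (src F). \<forall>Y\<in>Obj (src F). \<forall>Z\<in>Obj (src F).
        \<forall>g\<in>Hom (src F) X Y. \<forall>h\<in>Hom (src F) Y Z.
        on_hom F X Z (Comp (src F) X h g) =
          Comp (tgt F) (on_obj F X) (on_hom F Y Z h) (on_hom F X Y g))"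

definition surj_on_objects :: "('o, 'h, 'p, 'k) func \<Rightarrow> bool" where
  "surj_on_objects F \<longleftrightarrow> (\<forall>Y\<in>Obj (tgt F). \<exists>X\<in>Obj (src F). on_obj F X = Y)"

text \<open>Surjectivity on each hom-set, i.e. fullness.\<close>

definition surj_on_morphisms :: "('o, 'h, 'p, 'k) func \<Rightarrow> bool" where
  "surj_on_morphisms F \<longleftrightarrow>
     (\<forall>X\<in>Obj (src F). \<forall>Y\<in>Obj (src F). \<forall>k\<in>Hom (tgt F) (on_obj F X) (on_obj F Y).
        \<exists>h\<in>Hom (src F) X Y. on_hom F X Y h = k)"


section \<open>Constant rank factorizations\<close>

text \<open>The type argument is the type of the points of the phase spaces. Objects carry their phase
  space: \<open>(C, \<phi>, U)\<close> and \<open>(C, \<phi>\<^sub>1, \<phi>\<^sub>2, U)\<close>.\<close>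

type_synonym ('m, 'n, 'c) const_obj = "'c mfd \<times> ('m \<Rightarrow> 'c) \<times> ('c \<Rightarrow> 'n)"
type_synonym ('m1, 'm2, 'n, 'c) crse_obj = "'c mfd \<times> ('m1 \<Rightarrow> 'c) \<times> ('m2 \<Rightarrow> 'c) \<times> ('c \<Rightarrow> 'n)"

definition constant_rank_factorization ::
    "'m mfd \<Rightarrow> 'n mfd \<Rightarrow> ('m \<Rightarrow> 'n) \<Rightarrow> 'c mfd \<Rightarrow> ('m \<Rightarrow> 'c) \<Rightarrow> ('c \<Rightarrow> 'n) \<Rightarrow> bool" where
  "constant_rank_factorization M N u C \<phi> U \<longleftrightarrow>
     smooth_manifold C \<and> smooth_map M C \<phi> \<and> constant_rank M C \<phi> \<and> smooth_map C N U \<and>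
     u = compose (pts M) U \<phi>"

definition Const ::
    "'c itself \<Rightarrow> 'm mfd \<Rightarrow> 'n mfd \<Rightarrow> ('m \<Rightarrow> 'n) \<Rightarrow> (('m, 'n, 'c) const_obj, 'c \<Rightarrow> 'c) category" where
  "Const TC M N u = \<lparr>
     Obj = {(C, \<phi>, U). constant_rank_factorization M N u C \<phi> U},
     Hom = (\<lambda>(C, \<phi>, U) (C', \<phi>', U').
       {c. smooth_map C C' c \<and> \<phi>' = compose (pts M) c \<phi> \<and> U = compose (pts C) U' c}),
     Id = (\<lambda>(C, \<phi>, U). \<lambda>p\<in>pts C. p),
     Comp = (\<lambda>(C, \<phi>, U) d c. compose (pts C) d c)\<rparr>"

definition CRSE ::
    "'c itself \<Rightarrow> 'm1 mfd \<Rightarrow> 'm2 mfd \<Rightarrow> 'n mfd \<Rightarrow> ('m1 \<Rightarrow> 'n) \<Rightarrow> ('m2 \<Rightarrow> 'n) \<Rightarrow>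
     (('m1, 'm2, 'n, 'c) crse_obj, 'c \<Rightarrow> 'c) category" where
  "CRSE TC M1 M2 N u1 u2 = \<lparr>
     Obj = {(C, \<phi>1, \<phi>2, U).
       smooth_manifold C \<and>
       smooth_map M1 C \<phi>1 \<and> constant_rank M1 C \<phi>1 \<and>
       smooth_map M2 C \<phi>2 \<and> constant_rank M2 C \<phi>2 \<and>
       smooth_map C N U \<and>
       u1 = compose (pts M1) U \<phi>1 \<and> u2 = compose (pts M2) U \<phi>2},
     Hom = (\<lambda>(C, \<phi>1, \<phi>2, U) (C', \<phi>1', \<phi>2', U').
       {c. smooth_map C C' c \<and>
           \<phi>1' = compose (pts M1) c \<phi>1 \<and> \<phi>2' = compose (pts M2) c \<phi>2 \<and>
           U = compose (pts C) U' c}),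
     Id = (\<lambda>(C, \<phi>1, \<phi>2, U). \<lambda>p\<in>pts C. p),
     Comp = (\<lambda>(C, \<phi>1, \<phi>2, U) d c. compose (pts C) d c)\<rparr>"

definition forget1 ::
    "'c itself \<Rightarrow> 'm1 mfd \<Rightarrow> 'm2 mfd \<Rightarrow> 'n mfd \<Rightarrow> ('m1 \<Rightarrow> 'n) \<Rightarrow> ('m2 \<Rightarrow> 'n) \<Rightarrow>
     (('m1, 'm2, 'n, 'c) crse_obj, 'c \<Rightarrow> 'c, ('m1, 'n, 'c) const_obj, 'c \<Rightarrow> 'c) func" where
  "forget1 TC M1 M2 N u1 u2 = \<lparr>
     src = CRSE TC M1 M2 N u1 u2,
     tgt = Const TC M1 N u1,
     on_obj = (\<lambda>(C, \<phi>1, \<phi>2, U). (C, \<phi>1, U)),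
     on_hom = (\<lambda>X Y c. c)\<rparr>"

definition forget2 ::
    "'c itself \<Rightarrow> 'm1 mfd \<Rightarrow> 'm2 mfd \<Rightarrow> 'n mfd \<Rightarrow> ('m1 \<Rightarrow> 'n) \<Rightarrow> ('m2 \<Rightarrow> 'n) \<Rightarrow>
     (('m1, 'm2, 'n, 'c) crse_obj, 'c \<Rightarrow> 'c, ('m2, 'n, 'c) const_obj, 'c \<Rightarrow> 'c) func" where
  "forget2 TC M1 M2 N u1 u2 = \<lparr>
     src = CRSE TC M1 M2 N u1 u2,
     tgt = Const TC M2 N u2,
     on_obj = (\<lambda>(C, \<phi>1, \<phi>2, U). (C, \<phi>2, U)),
     on_hom = (\<lambda>X Y c. c)\<rparr>"

lemma functorial_forget1: "functorial (forget1 TC M1 M2 N u1 u2)"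
  by (auto simp: functorial_def forget1_def CRSE_def Const_def constant_rank_factorization_def)

lemma functorial_forget2: "functorial (forget2 TC M1 M2 N u1 u2)"
  by (auto simp: functorial_def forget2_def CRSE_def Const_def constant_rank_factorization_def)

end

(* A diffeomorphism f carries a constant rank map phi to the constant rank map phi o f: by the chain
   rule the Jacobian of phi o f is that of phi times an invertible matrix. Hence (phi, phi o f, U)
   lies over a factorization (phi, U) of u1, and (phi o f^-1, phi, U) over one of u2. The functors
   fail to be full already in dimension 0: for M = N a point and C = {0, 1}, a constant self-map of C
   is compatible with phi1 = 0 but not with phi2 = 1, or conversely. *)
theory Submission
  imports Defs
begin

section \<open>The chain rule in coordinates\<close>

text \<open>Smoothness is defined through iterated partial derivatives of functions of a real
  sequence, and the product topology on sequences comes from no norm. The chain rule is therefore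
  derived from the one-variable mean value theorem, applied to one coordinate at a time, with
  continuity of the partial derivatives doing the rest. \<open>partial_deriv\<close> is total, with
  an arbitrary value where no derivative exists. Functions that agree on an open set thus have equal
  derivatives only on that set, which explains the recurring congruence and openness arguments. The
  Jacobian of \<open>f\<close> is handled without comparing dimensions: the chain rule for f o f^-1
  = id gives it a right inverse, and multiplication by a matrix with a right inverse already
  preserves the column space.\<close>

lemma Euclidean_space_eq_top_of_set: "Euclidean_space n = top_of_set {x. \<forall>i\<ge>n. x i = 0}"
  by (simp add: Euclidean_space_def euclidean_product_topology)

lemma openin_Euclidean_spaceD:
  assumes "openin (Euclidean_space n) W" "x \<in> W" "i \<ge> n"
  shows "x i = 0"
  using assms openin_subset[OF assms(1)] by (auto simp: topspace_Euclidean_space)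

lemma continuous_map_Euclidean_open:
  assumes "openin (Euclidean_space n) W"
  shows "continuous_map (subtopology (Euclidean_space n) W) euclideanreal g \<longleftrightarrow> continuous_on W g"
proof -
  have "{x. \<forall>i\<ge>n. x i = 0} \<inter> W = W"
    using openin_Euclidean_spaceD[OF assms] by auto
  then show ?thesis
    by (simp add: Euclidean_space_eq_top_of_set subtopology_subtopology)
qed

section \<open>Boxes and coordinate lines in open subsets of n-space\<close>

lemma open_fun_contains_box:
  fixes U :: "('a \<Rightarrow> real) set"
  assumes "open U" "x \<in> U"
  obtains e where "e > 0" "\<And>y. (\<And>i. \<bar>y i - x i\<bar> < e) \<Longrightarrow> y \<in> U"
proof -
  obtain X where X: "x \<in> Pi\<^sub>E UNIV X" "\<And>i. open (X i)" "finite {i. X i \<noteq> UNIV}"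
    "Pi\<^sub>E UNIV X \<subseteq> U"
    using product_topology_open_contains_basis[of "\<lambda>i. euclidean" UNIV U x] assms
    by (auto simp: open_fun_def)
  have "\<exists>e>0. \<forall>r. \<bar>r - x i\<bar> < e \<longrightarrow> r \<in> X i" for i
  proof -
    have "x i \<in> X i" using X(1) by auto
    then show ?thesis
      using X(2)[of i] by (auto simp: open_dist dist_real_def)
  qed
  then obtain d where d: "\<And>i. d i > 0" "\<And>i r. \<bar>r - x i\<bar> < d i \<Longrightarrow> r \<in> X i"
    by metis
  \<comment> \<open>Only finitely many factors are constrained; the inserted \<open>1\<close> covers
    the case that none is.\<close>
  let ?e = "Min (insert 1 (d ` {i. X i \<noteq> UNIV}))"
  have "?e > 0" using X(3) d(1) by simp
  moreover have "y \<in> U" if y: "\<And>i. \<bar>y i - x i\<bar> < ?e" for y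
  proof -
    have "y i \<in> X i" for i
    proof (cases "X i = UNIV")
      case False
      then have "?e \<le> d i" using X(3) by (intro Min_le) auto
      then show ?thesis using y[of i] d(2) by force
    qed simp
    then show ?thesis using X(4) by auto
  qed
  ultimately show thesis using that by blast
qed

text \<open>Coordinates from \<open>n\<close> on vanish throughout n-space, so a box only has to
  bound the first \<open>n\<close>.\<close>

lemma openin_Euclidean_contains_box:
  assumes "openin (Euclidean_space n) W" "x \<in> W"
  obtains e where "e > 0"
    "\<And>y. (\<And>i. i \<ge> n \<Longrightarrow> y i = 0) \<Longrightarrow> (\<And>i. i < n \<Longrightarrow> \<bar>y i - x i\<bar> < e) \<Longrightarrow> y \<in> W"
proof -
  obtain U where U: "open U" "W = {x. \<forall>i\<ge>n. x i = 0} \<inter> U"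
    using assms(1) by (auto simp: Euclidean_space_eq_top_of_set openin_open)
  with assms obtain e where e: "e > 0" "\<And>y. (\<And>i. \<bar>y i - x i\<bar> < e) \<Longrightarrow> y \<in> U"
    using open_fun_contains_box[of U x] by auto
  have "y \<in> W" if y: "\<And>i. i \<ge> n \<Longrightarrow> y i = 0" "\<And>i. i < n \<Longrightarrow> \<bar>y i - x i\<bar> < e" for y
  proof -
    have "\<bar>y i - x i\<bar> < e" for i
      using y openin_Euclidean_spaceD[OF assms, of i] e(1) by (cases "i < n") auto
    then show ?thesis using e(2) y(1) U(2) by auto
  qed
  with e(1) show thesis using that by blast
qed

text \<open>Short coordinate segments stay in an open set, which lets partial derivatives be
  computed from the values on \<open>W\<close> alone.\<close>

lemma eventually_coordinate_line:
  assumes "openin (Euclidean_space n) W" "x \<in> W" "i < n"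
  shows "\<forall>\<^sub>F t in nhds (x i). x(i := t) \<in> W"
proof -
  obtain e where e: "e > 0"
    "\<And>y. (\<And>i. i \<ge> n \<Longrightarrow> y i = 0) \<Longrightarrow> (\<And>i. i < n \<Longrightarrow> \<bar>y i - x i\<bar> < e) \<Longrightarrow> y \<in> W"
    using openin_Euclidean_contains_box[OF assms(1,2)] by blast
  have "x(i := t) \<in> W" if "dist t (x i) < e" for t
    using that assms openin_Euclidean_spaceD[OF assms(1,2)] e(1)
    by (intro e(2)) (auto simp: dist_real_def)
  then show ?thesis using e(1) by (auto simp: eventually_nhds_metric)
qed

section \<open>Functions of class C^k: locality, sums and products\<close>

lemma has_partial_deriv:
  "(\<lambda>t. g (x(i := t))) differentiable at (x i) \<longleftrightarrow>
   ((\<lambda>t. g (x(i := t))) has_real_derivative partial_deriv i g x) (at (x i))"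
  by (simp add: partial_deriv_def DERIV_deriv_iff_real_differentiable)

lemma partial_deriv_eqI:
  "((\<lambda>t. g (x(i := t))) has_real_derivative D) (at (x i)) \<Longrightarrow> partial_deriv i g x = D"
  by (simp add: partial_deriv_def DERIV_imp_deriv)

lemma eventually_eq_coordinate_line:
  assumes "openin (Euclidean_space n) W" "x \<in> W" "i < n" "\<And>y. y \<in> W \<Longrightarrow> g y = h y"
  shows "\<forall>\<^sub>F t in nhds (x i). g (x(i := t)) = h (x(i := t))"
  using eventually_coordinate_line[OF assms(1-3)] by eventually_elim (use assms(4) in auto)

lemma partial_deriv_cong:
  assumes "openin (Euclidean_space n) W" "x \<in> W" "i < n" "\<And>y. y \<in> W \<Longrightarrow> g y = h y"
  shows "partial_deriv i g x = partial_deriv i h x"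
  unfolding partial_deriv_def by (intro deriv_cong_ev eventually_eq_coordinate_line[OF assms]) auto

lemma C_k_continuous_on:
  assumes "openin (Euclidean_space n) W" "C_k n W k g"
  shows "continuous_on W g"
  using assms by (cases k) (auto simp: continuous_map_Euclidean_open)

text \<open>Agreement on \<open>W\<close> passes to the partial derivatives only on
  \<open>W\<close>, so the induction ranges over all pairs \<open>g\<close>,
  \<open>h\<close>.\<close>

lemma C_k_cong:
  assumes W: "openin (Euclidean_space n) W" and "\<And>x. x \<in> W \<Longrightarrow> g x = h x" "C_k n W k g"
  shows "C_k n W k h"
  using assms(2,3)
proof (induction k arbitrary: g h)
  case 0
  then show ?case
    by (simp add: continuous_map_Euclidean_open[OF W] cong: continuous_on_cong)
next
  case (Suc k)
  have cont: "continuous_on W h"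
    using C_k_continuous_on[OF W Suc.prems(2)] Suc.prems(1) by (simp cong: continuous_on_cong)
  have "(\<lambda>t. h (x(i := t))) differentiable at (x i)" if i: "i < n" and x: "x \<in> W" for i x
  proof -
    have "((\<lambda>t. g (x(i := t))) has_real_derivative partial_deriv i g x) (at (x i))"
      using Suc.prems(2) i x by (simp flip: has_partial_deriv)
    then have "((\<lambda>t. h (x(i := t))) has_real_derivative partial_deriv i g x) (at (x i))"
      using DERIV_cong_ev[OF refl eventually_eq_coordinate_line[OF W x i, of g h] refl] Suc.prems(1)
      by blast
    then show ?thesis using real_differentiable_def by blast
  qed
  moreover have "C_k n W k (partial_deriv i h)" if i: "i < n" for i
  proof (rule Suc.IH)
    show "partial_deriv i g x = partial_deriv i h x" if "x \<in> W" for x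
      using partial_deriv_cong[OF W that i] Suc.prems(1) by blast
    show "C_k n W k (partial_deriv i g)" using Suc.prems(2) i by simp
  qed
  ultimately show ?case using cont by (simp add: continuous_map_Euclidean_open[OF W])
qed

lemma C_k_SucD: "C_k n W (Suc k) g \<Longrightarrow> C_k n W k g"
  by (induction k arbitrary: g) auto

lemma C_k_subset:
  assumes "openin (Euclidean_space n) W" "openin (Euclidean_space n) V" "V \<subseteq> W" "C_k n W k g"
  shows "C_k n V k g"
  using assms(4)
proof (induction k arbitrary: g)
  case 0
  then show ?case using assms continuous_on_subset by (auto simp: continuous_map_Euclidean_open)
next
  case (Suc k)
  then show ?case
    using assms C_k_continuous_on[OF assms(1) Suc.prems] continuous_on_subset
    by (auto simp: continuous_map_Euclidean_open)
qed

text \<open>For a composite of maps between manifolds, one chart of the middle manifold reaches only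
  part of the domain; this lemma glues the parts.\<close>

lemma C_k_local:
  assumes W: "openin (Euclidean_space n) W"
    and "\<And>x. x \<in> W \<Longrightarrow> \<exists>V. openin (Euclidean_space n) V \<and> x \<in> V \<and> V \<subseteq> W \<and> C_k n V k g"
  shows "C_k n W k g"
proof -
  have cont: "continuous_on W g"
    if loc: "\<And>x. x \<in> W \<Longrightarrow> \<exists>V. openin (Euclidean_space n) V \<and> x \<in> V \<and> V \<subseteq> W \<and> C_k n V k g" for k g
  proof -
    have "continuous (at x within W) g" if x: "x \<in> W" for x
    proof -
      obtain V where V: "openin (Euclidean_space n) V" "x \<in> V" "V \<subseteq> W" "C_k n V k g"
        using loc[OF x] by blast
      obtain U where U: "open U" "V = {x. \<forall>i\<ge>n. x i = 0} \<inter> U"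
        using V(1) by (auto simp: Euclidean_space_eq_top_of_set openin_open)
      \<comment> \<open>\<open>V\<close> is cut out of \<open>W\<close> by a set open in the whole
        sequence space, so both give the same limits at \<open>x\<close>.\<close>
      have "W \<inter> U = V" using U(2) V(3) openin_Euclidean_spaceD[OF W] by auto
      then have "at x within W = at x within V"
        using U V(2,3) by (intro at_within_nhd[where S = U]) auto
      then show ?thesis
        using C_k_continuous_on[OF V(1,4)] V(2) by (auto simp: continuous_on_eq_continuous_within)
    qed
    then show ?thesis by (simp add: continuous_on_eq_continuous_within)
  qed
  show ?thesis using assms(2)
  proof (induction k arbitrary: g)
    case 0
    then show ?case using cont[of 0 g] by (simp add: continuous_map_Euclidean_open[OF W])
  next
    case (Suc k)
    have "(\<lambda>t. g (x(i := t))) differentiable at (x i)" if "i < n" "x \<in> W" for i x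
      using Suc.prems[OF that(2)] that(1) by auto
    moreover have "C_k n W k (partial_deriv i g)" if "i < n" for i
      using Suc.prems that by (intro Suc.IH) fastforce
    ultimately show ?case
      using cont[OF Suc.prems] by (simp add: continuous_map_Euclidean_open[OF W])
  qed
qed

lemma C_k_const: "C_k n W k (\<lambda>x. c)"
proof (induction k arbitrary: c)
  case (Suc k)
  have "partial_deriv i (\<lambda>x. c) = (\<lambda>x. 0)" for i
    by (simp add: partial_deriv_def fun_eq_iff)
  with Suc show ?case by simp
qed simp

lemma C_k_add:
  assumes W: "openin (Euclidean_space n) W" and "C_k n W k g" "C_k n W k h"
  shows "C_k n W k (\<lambda>x. g x + h x)"
  using assms(2,3)
proof (induction k arbitrary: g h)
  case 0
  then show ?case by (simp add: continuous_map_Euclidean_open[OF W] continuous_on_add)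
next
  case (Suc k)
  have D: "((\<lambda>t. g (x(i := t)) + h (x(i := t))) has_real_derivative
      partial_deriv i g x + partial_deriv i h x) (at (x i))" if "i < n" "x \<in> W" for i x
    using Suc.prems that by (intro DERIV_add) (auto simp flip: has_partial_deriv)
  have "C_k n W k (partial_deriv i (\<lambda>x. g x + h x))" if i: "i < n" for i
  proof (rule C_k_cong[OF W])
    show "C_k n W k (\<lambda>x. partial_deriv i g x + partial_deriv i h x)"
      using Suc.prems i by (intro Suc.IH) auto
  qed (simp add: partial_deriv_eqI[OF D] i)
  moreover have "continuous_on W (\<lambda>x. g x + h x)"
    using Suc.prems C_k_continuous_on[OF W] by (intro continuous_on_add) blast+
  ultimately show ?case
    using D by (auto simp: continuous_map_Euclidean_open[OF W] real_differentiable_def)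
qed

lemma C_k_mult:
  assumes W: "openin (Euclidean_space n) W" and "C_k n W k g" "C_k n W k h"
  shows "C_k n W k (\<lambda>x. g x * h x)"
  using assms(2,3)
proof (induction k arbitrary: g h)
  case 0
  then show ?case by (simp add: continuous_map_Euclidean_open[OF W] continuous_on_mult)
next
  case (Suc k)
  have D: "((\<lambda>t. g (x(i := t)) * h (x(i := t))) has_real_derivative
      partial_deriv i g x * h x + partial_deriv i h x * g x) (at (x i))" if "i < n" "x \<in> W" for i x
  proof -
    have "((\<lambda>t. g (x(i := t))) has_real_derivative partial_deriv i g x) (at (x i))"
      "((\<lambda>t. h (x(i := t))) has_real_derivative partial_deriv i h x) (at (x i))"
      using Suc.prems that by (auto simp flip: has_partial_deriv)
    from DERIV_mult[OF this] show ?thesis by simp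
  qed
  have "C_k n W k (partial_deriv i (\<lambda>x. g x * h x))" if i: "i < n" for i
  proof (rule C_k_cong[OF W])
    \<comment> \<open>Each term of the product rule keeps one undifferentiated factor, which must
      itself be of order \<open>k\<close>; hence the weakening from \<open>Suc k\<close>.\<close>
    show "C_k n W k (\<lambda>x. partial_deriv i g x * h x + partial_deriv i h x * g x)"
      using Suc.prems C_k_SucD[OF Suc.prems(1)] C_k_SucD[OF Suc.prems(2)] i
      by (intro C_k_add[OF W] Suc.IH) auto
  qed (simp add: partial_deriv_eqI[OF D] i)
  moreover have "continuous_on W (\<lambda>x. g x * h x)"
    using Suc.prems C_k_continuous_on[OF W] by (intro continuous_on_mult) blast+
  ultimately show ?case
    using D by (auto simp: continuous_map_Euclidean_open[OF W] real_differentiable_def)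
qed

lemma C_k_sum:
  assumes W: "openin (Euclidean_space n) W" and "\<And>j. j \<in> J \<Longrightarrow> C_k n W k (g j)"
  shows "C_k n W k (\<lambda>x. \<Sum>j\<in>J. g j x)"
  using assms(2)
  \<comment> \<open>For infinite \<open>J\<close> the sum is 0 by convention, a constant.\<close>
  by (induction J rule: infinite_finite_induct) (simp_all add: C_k_const C_k_add[OF W])

section \<open>The chain rule along curves and for C^k functions\<close>

lemma tendsto_coordinatewise:
  fixes f :: "'a \<Rightarrow> 'i \<Rightarrow> real"
  assumes "\<And>i. ((\<lambda>t. f t i) \<longlongrightarrow> l i) F"
  shows "(f \<longlongrightarrow> l) F"
proof -
  have "limitin (product_topology (\<lambda>i. euclideanreal) UNIV) f l F"
    using assms by (simp add: limitin_componentwise)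
  then show ?thesis by (simp add: euclidean_product_topology)
qed

text \<open>Measuring \<open>s\<close> by its distance from \<open>a\<close> treats both orders of
  \<open>a\<close> and \<open>b\<close> alike, and it is the form in which points of a box are
  bounded. For \<open>a = b\<close> both sides of the identity are 0.\<close>

lemma MVT_unordered:
  fixes g :: "real \<Rightarrow> real"
  assumes "\<And>s. \<bar>s - a\<bar> \<le> \<bar>b - a\<bar> \<Longrightarrow> (g has_real_derivative g' s) (at s)"
  shows "\<exists>s. \<bar>s - a\<bar> \<le> \<bar>b - a\<bar> \<and> g b - g a = g' s * (b - a)"
proof -
  consider "a < b" | "b < a" | "a = b" by linarith
  then show ?thesis
  proof cases
    case 1
    then obtain s where "a < s" "s < b" "g b - g a = (b - a) * g' s"
      using MVT2[of a b g g'] assms by auto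
    then show ?thesis by (intro exI[of _ s]) (auto simp: mult.commute)
  next
    case 2
    then obtain s where "b < s" "s < a" "g a - g b = (a - b) * g' s"
      using MVT2[of b a g g'] assms by auto
    then show ?thesis by (intro exI[of _ s]) (auto simp: algebra_simps)
  qed auto
qed

text \<open>Each coordinate step has its own intermediate point \<open>\<xi> j\<close>. The
  coordinatewise bounds force every \<open>\<xi> j\<close> to tend to \<open>x\<close> when
  \<open>y\<close> does, which is what differentiation along a curve needs.\<close>

lemma C_1_mean_value:
  assumes C1: "C_k m W 1 h"
    and box: "\<And>y. (\<And>i. i \<ge> m \<Longrightarrow> y i = 0) \<Longrightarrow> (\<And>i. i < m \<Longrightarrow> \<bar>y i - x i\<bar> < e) \<Longrightarrow> y \<in> W"
    and x: "\<And>i. i \<ge> m \<Longrightarrow> x i = 0"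
    and y: "\<And>i. i \<ge> m \<Longrightarrow> y i = 0" "\<And>i. i < m \<Longrightarrow> \<bar>y i - x i\<bar> < e"
  obtains \<xi> where "\<And>j. j < m \<Longrightarrow> \<xi> j \<in> W" "\<And>j i. j < m \<Longrightarrow> \<bar>\<xi> j i - x i\<bar> \<le> \<bar>y i - x i\<bar>"
    "h y - h x = (\<Sum>j<m. partial_deriv j h (\<xi> j) * (y j - x j))"
proof -
  \<comment> \<open>Pass from x to y by changing one coordinate at a time; all intermediate points stay in the box.\<close>
  define z where "z k = (\<lambda>i. if i < k then y i else x i)" for k
  have step: "\<exists>p. p \<in> W \<and> (\<forall>i. \<bar>p i - x i\<bar> \<le> \<bar>y i - x i\<bar>) \<and>
      h (z (Suc j)) - h (z j) = partial_deriv j h p * (y j - x j)" if j: "j < m" for j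
  proof -
    have near: "\<bar>((z j)(j := s)) i - x i\<bar> \<le> \<bar>y i - x i\<bar>" if "\<bar>s - x j\<bar> \<le> \<bar>y j - x j\<bar>" for s i
      using that by (auto simp: z_def)
    have W: "(z j)(j := s) \<in> W" if s: "\<bar>s - x j\<bar> \<le> \<bar>y j - x j\<bar>" for s
    proof (rule box)
      show "((z j)(j := s)) i = 0" if "i \<ge> m" for i
        using that j x y by (auto simp: z_def)
      show "\<bar>((z j)(j := s)) i - x i\<bar> < e" if "i < m" for i
        using near[OF s, of i] y(2)[OF that] by linarith
    qed
    have "((\<lambda>s. h ((z j)(j := s))) has_real_derivative partial_deriv j h ((z j)(j := s))) (at s)"
      if "\<bar>s - x j\<bar> \<le> \<bar>y j - x j\<bar>" for s
    proof -
      have "(\<lambda>t. h (((z j)(j := s))(j := t))) differentiable at (((z j)(j := s)) j)"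
        using C1 j W[OF that] by fastforce
      then show ?thesis by (subst (asm) has_partial_deriv) simp
    qed
    from MVT_unordered[OF this] obtain s where s: "\<bar>s - x j\<bar> \<le> \<bar>y j - x j\<bar>"
      "h ((z j)(j := y j)) - h ((z j)(j := x j)) = partial_deriv j h ((z j)(j := s)) * (y j - x j)"
      by blast
    moreover have "(z j)(j := y j) = z (Suc j)" "(z j)(j := x j) = z j"
      by (auto simp: z_def)
    ultimately show ?thesis using W near by metis
  qed
  then obtain \<xi> where \<xi>: "\<And>j. j < m \<Longrightarrow> \<xi> j \<in> W \<and> (\<forall>i. \<bar>\<xi> j i - x i\<bar> \<le> \<bar>y i - x i\<bar>) \<and>
      h (z (Suc j)) - h (z j) = partial_deriv j h (\<xi> j) * (y j - x j)"
    by metis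
  have "z 0 = x" "z m = y" using x y(1) by (auto simp: z_def fun_eq_iff not_less)
  then have "h y - h x = (\<Sum>j<m. h (z (Suc j)) - h (z j))"
    using sum_lessThan_telescope[of "\<lambda>k. h (z k)" m] by simp
  also have "\<dots> = (\<Sum>j<m. partial_deriv j h (\<xi> j) * (y j - x j))"
    using \<xi> by (intro sum.cong) auto
  finally show thesis using that \<xi> by blast
qed

text \<open>Divide the mean value identity by \<open>t - a\<close>: the difference quotients of the
  coordinates tend to \<open>D j\<close>, and the partial derivatives at the intermediate points
  tend to those at \<open>\<gamma> a\<close> by continuity.\<close>

lemma has_real_derivative_C_1_curve:
  assumes W: "openin (Euclidean_space m) W" and C1: "C_k m W 1 h"
    and \<gamma>: "\<forall>\<^sub>F t in nhds a. \<gamma> t \<in> W"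
    and D: "\<And>j. j < m \<Longrightarrow> ((\<lambda>t. \<gamma> t j) has_real_derivative D j) (at a)"
  shows "((\<lambda>t. h (\<gamma> t)) has_real_derivative (\<Sum>j<m. partial_deriv j h (\<gamma> a) * D j)) (at a)"
proof -
  have aW: "\<gamma> a \<in> W" using \<gamma> by (rule eventually_nhds_x_imp_x)
  obtain e where e: "e > 0"
    "\<And>y. (\<And>i. i \<ge> m \<Longrightarrow> y i = 0) \<Longrightarrow> (\<And>i. i < m \<Longrightarrow> \<bar>y i - \<gamma> a i\<bar> < e) \<Longrightarrow> y \<in> W"
    using openin_Euclidean_contains_box[OF W aW] by blast
  have \<gamma>a: "\<forall>\<^sub>F t in at a. \<gamma> t \<in> W" using \<gamma> by (auto simp: eventually_nhds_conv_at)
  have lim: "((\<lambda>t. \<gamma> t i) \<longlongrightarrow> \<gamma> a i) (at a)" for i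
  proof (cases "i < m")
    case True
    then show ?thesis using DERIV_isCont[OF D] by (simp add: isCont_def)
  next
    case False
    \<comment> \<open>The product topology asks for the limits of the coordinates from
      \<open>m\<close> on as well; these are 0 as long as the curve stays in
      \<open>W\<close>.\<close>
    then have "\<forall>\<^sub>F t in at a. \<gamma> t i = \<gamma> a i"
      using \<gamma>a by (auto simp: openin_Euclidean_spaceD[OF W] aW elim: eventually_mono)
    then show ?thesis by (rule tendsto_eventually)
  qed
  have near: "\<forall>\<^sub>F t in at a. \<forall>i\<in>{..<m}. \<bar>\<gamma> t i - \<gamma> a i\<bar> < e"
    using lim e(1) by (intro eventually_ball_finite) (auto simp: tendsto_iff dist_real_def)
  define P where "P t \<xi> \<longleftrightarrow> (\<forall>j<m. \<xi> j \<in> W \<and> (\<forall>i. \<bar>\<xi> j i - \<gamma> a i\<bar> \<le> \<bar>\<gamma> t i - \<gamma> a i\<bar>)) \<and>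
    h (\<gamma> t) - h (\<gamma> a) = (\<Sum>j<m. partial_deriv j h (\<xi> j) * (\<gamma> t j - \<gamma> a j))" for t \<xi>
  have "\<forall>\<^sub>F t in at a. \<exists>\<xi>. P t \<xi>"
    using \<gamma>a near
  proof eventually_elim
    case (elim t)
    show ?case
    proof (rule C_1_mean_value[OF C1, of "\<gamma> a" e "\<gamma> t"])
      show "\<gamma> a i = 0" "\<gamma> t i = 0" if "i \<ge> m" for i
        using openin_Euclidean_spaceD[OF W] aW elim(1) that by auto
      show "\<bar>\<gamma> t i - \<gamma> a i\<bar> < e" if "i < m" for i
        using elim(2) that by simp
      show ?case if "\<And>j. j < m \<Longrightarrow> \<xi> j \<in> W" "\<And>j i. j < m \<Longrightarrow> \<bar>\<xi> j i - \<gamma> a i\<bar> \<le> \<bar>\<gamma> t i - \<gamma> a i\<bar>"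
        "h (\<gamma> t) - h (\<gamma> a) = (\<Sum>j<m. partial_deriv j h (\<xi> j) * (\<gamma> t j - \<gamma> a j))" for \<xi>
        using that by (auto simp: P_def)
    qed (rule e(2))
  qed
  \<comment> \<open>The intermediate points become functions of \<open>t\<close>, so that their
    limits can be taken.\<close>
  moreover define \<xi> where "\<xi> t = (SOME \<xi>. P t \<xi>)" for t
  ultimately have \<xi>: "\<forall>\<^sub>F t in at a. P t (\<xi> t)"
    by (simp add: some_eq_ex)
  have "((\<lambda>t. partial_deriv j h (\<xi> t j)) \<longlongrightarrow> partial_deriv j h (\<gamma> a)) (at a)" if j: "j < m" for j
  proof (rule continuous_on_tendsto_compose[where s = W and f = "partial_deriv j h"])
    have "C_k m W 0 (partial_deriv j h)" using C1 j by simp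
    then show "continuous_on W (partial_deriv j h)" by (rule C_k_continuous_on[OF W])
    show "\<forall>\<^sub>F t in at a. \<xi> t j \<in> W" using \<xi> by eventually_elim (use j in \<open>auto simp: P_def\<close>)
    show "((\<lambda>t. \<xi> t j) \<longlongrightarrow> \<gamma> a) (at a)"
    proof (rule tendsto_coordinatewise)
      fix i
      have "((\<lambda>t. \<xi> t j i - \<gamma> a i) \<longlongrightarrow> 0) (at a)"
      proof (rule Lim_null_comparison)
        show "\<forall>\<^sub>F t in at a. norm (\<xi> t j i - \<gamma> a i) \<le> \<bar>\<gamma> t i - \<gamma> a i\<bar>"
          using \<xi> by eventually_elim (use j in \<open>auto simp: P_def\<close>)
        show "((\<lambda>t. \<bar>\<gamma> t i - \<gamma> a i\<bar>) \<longlongrightarrow> 0) (at a)"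
          using lim[of i] by (intro tendsto_rabs_zero) (simp add: LIM_zero)
      qed
      then show "((\<lambda>t. \<xi> t j i) \<longlongrightarrow> \<gamma> a i) (at a)" by (rule LIM_zero_cancel)
    qed
  qed (rule aW)
  moreover have "((\<lambda>t. (\<gamma> t j - \<gamma> a j) / (t - a)) \<longlongrightarrow> D j) (at a)" if "j < m" for j
    using D[OF that] by (simp add: has_field_derivative_iff)
  ultimately have "((\<lambda>t. \<Sum>j<m. partial_deriv j h (\<xi> t j) * ((\<gamma> t j - \<gamma> a j) / (t - a))) \<longlongrightarrow>
      (\<Sum>j<m. partial_deriv j h (\<gamma> a) * D j)) (at a)"
    by (intro tendsto_sum tendsto_mult) auto
  moreover have "\<forall>\<^sub>F t in at a. (\<Sum>j<m. partial_deriv j h (\<xi> t j) * ((\<gamma> t j - \<gamma> a j) / (t - a))) =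
      (h (\<gamma> t) - h (\<gamma> a)) / (t - a)"
    using \<xi> by eventually_elim (simp add: P_def sum_divide_distrib)
  ultimately show ?thesis
    unfolding has_field_derivative_iff by (rule Lim_transform_eventually)
qed

text \<open>This is the curve rule for the image under \<open>G\<close> of a coordinate
  line.\<close>

lemma has_partial_deriv_compose:
  assumes V: "openin (Euclidean_space n) V" and W: "openin (Euclidean_space m) W"
    and G: "G ` V \<subseteq> W" "\<And>j. j < m \<Longrightarrow> C_k n V 1 (\<lambda>x. G x j)" and h: "C_k m W 1 h"
    and x: "x \<in> V" and i: "i < n"
  shows "((\<lambda>t. h (G (x(i := t)))) has_real_derivative
    (\<Sum>j<m. partial_deriv j h (G x) * partial_deriv i (\<lambda>y. G y j) x)) (at (x i))"
proof -
  have ev: "\<forall>\<^sub>F t in nhds (x i). G (x(i := t)) \<in> W"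
    using eventually_coordinate_line[OF V x i] by eventually_elim (use G(1) in auto)
  have "((\<lambda>t. G (x(i := t)) j) has_real_derivative partial_deriv i (\<lambda>y. G y j) x) (at (x i))"
    if "j < m" for j
    using G(2)[OF that] x i has_partial_deriv[of "\<lambda>y. G y j" x i] by simp
  from has_real_derivative_C_1_curve[OF W h ev this] show ?thesis by simp
qed

lemma C_k_SucD_1: "C_k n W (Suc k) g \<Longrightarrow> C_k n W 1 g"
  by (induction k) (auto dest: C_k_SucD)

text \<open>A partial derivative of the composite is a sum of products of
  \<open>partial_deriv j h\<close> after \<open>G\<close> with partial derivatives of
  \<open>G\<close>. The induction therefore varies \<open>h\<close> and keeps \<open>G\<close>
  fixed.\<close>

lemma C_k_compose:
  assumes V: "openin (Euclidean_space n) V" and W: "openin (Euclidean_space m) W"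
    and G: "G ` V \<subseteq> W" "\<And>j. j < m \<Longrightarrow> C_k n V k (\<lambda>x. G x j)" and h: "C_k m W k h"
  shows "C_k n V k (\<lambda>x. h (G x))"
  using G(2) h
proof (induction k arbitrary: h)
  case (Suc k)
  have D: "((\<lambda>t. h (G (x(i := t)))) has_real_derivative
      (\<Sum>j<m. partial_deriv j h (G x) * partial_deriv i (\<lambda>y. G y j) x)) (at (x i))"
    if "i < n" "x \<in> V" for i x
    by (rule has_partial_deriv_compose[OF V W G(1) C_k_SucD_1[OF Suc.prems(1)]
          C_k_SucD_1[OF Suc.prems(2)] that(2,1)])
  have cont: "continuous_on V (\<lambda>x. h (G x))"
    by (rule C_k_continuous_on[OF V Suc.IH[OF C_k_SucD[OF Suc.prems(1)] C_k_SucD[OF Suc.prems(2)]]])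
  have "C_k n V k (partial_deriv i (\<lambda>x. h (G x)))" if i: "i < n" for i
  proof (rule C_k_cong[OF V])
    show "C_k n V k (\<lambda>x. \<Sum>j<m. partial_deriv j h (G x) * partial_deriv i (\<lambda>y. G y j) x)"
    proof (intro C_k_sum[OF V] C_k_mult[OF V])
      fix j assume "j \<in> {..<m}"
      then have j: "j < m" by simp
      show "C_k n V k (\<lambda>x. partial_deriv j h (G x))"
      proof (rule Suc.IH[OF C_k_SucD[OF Suc.prems(1)]])
        show "C_k m W k (partial_deriv j h)" using Suc.prems(2) j by simp
      qed
      show "C_k n V k (partial_deriv i (\<lambda>y. G y j))" using Suc.prems(1)[OF j] i by simp
    qed
  qed (simp add: partial_deriv_eqI[OF D] i)
  moreover have "(\<lambda>t. h (G (x(i := t)))) differentiable at (x i)" if "i < n" "x \<in> V" for i x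
    using D[OF that] real_differentiable_def by blast
  ultimately show ?case
    using cont by (simp add: continuous_map_Euclidean_open[OF V])
next
  case 0
  \<comment> \<open>Continuity into the product topology concerns every coordinate; those from
    \<open>m\<close> on vanish because \<open>G\<close> takes values in \<open>W\<close>.\<close>
  have "continuous_on V (\<lambda>x. G x j)" for j
  proof (cases "j < m")
    case True
    then show ?thesis using 0 by (simp add: continuous_map_Euclidean_open[OF V])
  next
    case False
    then have "G x j = 0" if "x \<in> V" for x
      using that G(1) openin_Euclidean_spaceD[OF W, of "G x" j] by auto
    then show ?thesis by (simp cong: continuous_on_cong)
  qed
  then have "continuous_on V G" by (rule continuous_on_coordinatewise_then_product)
  moreover have "continuous_on W h" using 0 by (simp add: continuous_map_Euclidean_open[OF W])
  ultimately show ?case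
    using G(1) continuous_on_compose2[of W h V G] by (simp add: continuous_map_Euclidean_open[OF V])
qed

section \<open>Smooth maps of n-space, Jacobians and ranks\<close>

lemma smooth_euclid_compose:
  assumes V: "openin (Euclidean_space n) V" and W: "openin (Euclidean_space m) W"
    and G: "smooth_euclid n m V G" "G ` V \<subseteq> W" and H: "smooth_euclid m p W H"
  shows "smooth_euclid n p V (\<lambda>x. H (G x))"
  unfolding smooth_euclid_def
proof (intro allI impI)
  fix j k assume "j < p"
  then show "C_k n V k (\<lambda>x. H (G x) j)"
    using G(1) H by (intro C_k_compose[OF V W G(2), of k "\<lambda>y. H y j"]) (auto simp: smooth_euclid_def)
qed

lemma jacobian_carrier: "jacobian n m G x \<in> carrier_mat m n"
  by (simp add: jacobian_def)

lemma jacobian_cong: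
  assumes "openin (Euclidean_space n) V" "x \<in> V" "\<And>y. y \<in> V \<Longrightarrow> G y = H y"
  shows "jacobian n m G x = jacobian n m H x"
proof (rule eq_matI)
  fix i j assume "i < dim_row (jacobian n m H x)" "j < dim_col (jacobian n m H x)"
  then have "i < m" "j < n" by (simp_all add: jacobian_def)
  then show "jacobian n m G x $$ (i, j) = jacobian n m H x $$ (i, j)"
    using partial_deriv_cong[OF assms(1,2), of j "\<lambda>y. G y i" "\<lambda>y. H y i"] assms(3)
    by (simp add: jacobian_def)
qed (simp_all add: jacobian_def)

lemma jacobian_id: "jacobian n n (\<lambda>y. y) x = 1\<^sub>m n"
  by (rule eq_matI) (auto simp: jacobian_def partial_deriv_def)

lemma jacobian_compose:
  assumes V: "openin (Euclidean_space n) V" and W: "openin (Euclidean_space m) W"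
    and G: "smooth_euclid n m V G" "G ` V \<subseteq> W" and H: "smooth_euclid m p W H"
    and x: "x \<in> V"
  shows "jacobian n p (\<lambda>y. H (G y)) x = jacobian m p H (G x) * jacobian n m G x"
proof (rule eq_matI)
  fix i j
  assume "i < dim_row (jacobian m p H (G x) * jacobian n m G x)"
    "j < dim_col (jacobian m p H (G x) * jacobian n m G x)"
  then have ij: "i < p" "j < n" by (simp_all add: jacobian_def)
  have "partial_deriv j (\<lambda>y. H (G y) i) x =
      (\<Sum>k<m. partial_deriv k (\<lambda>y. H y i) (G x) * partial_deriv j (\<lambda>y. G y k) x)"
  proof (rule partial_deriv_eqI, rule has_partial_deriv_compose[OF V W G(2) _ _ x ij(2)])
    show "C_k n V 1 (\<lambda>y. G y k)" if "k < m" for k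
      using G(1) that unfolding smooth_euclid_def by blast
    show "C_k m W 1 (\<lambda>y. H y i)"
      using H ij(1) unfolding smooth_euclid_def by blast
  qed
  then show "jacobian n p (\<lambda>y. H (G y)) x $$ (i, j) =
      (jacobian m p H (G x) * jacobian n m G x) $$ (i, j)"
    using ij by (simp add: jacobian_def scalar_prod_def lessThan_atLeast0)
qed (simp_all add: jacobian_def)

text \<open>The column space of \<open>A * B\<close> always lies in that of \<open>A\<close>;
  conversely A x = (A B)(B' x). Only a right inverse of \<open>B\<close> enters, so \<open>n\<close>
  and \<open>m\<close> may differ a priori.\<close>

lemma rank_mult_right_invertible:
  fixes A :: "'a :: field mat"
  assumes A: "A \<in> carrier_mat nr n" and B: "B \<in> carrier_mat n m" and B': "B' \<in> carrier_mat m n"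
    and inv: "B * B' = 1\<^sub>m n"
  shows "vec_space.rank nr (A * B) = vec_space.rank nr A"
proof -
  interpret vec_space "TYPE('a)" nr .
  have AB: "A * B \<in> carrier_mat nr m" using A B by simp
  have "col_space (A * B) = col_space A"
  proof (intro equalityI subsetI)
    fix y assume "y \<in> col_space (A * B)"
    then obtain x where "x \<in> carrier_vec m" "y \<in> carrier_vec nr" "(A * B) *\<^sub>v x = y"
      using A B by (auto simp: col_space_eq[OF AB])
    then show "y \<in> col_space A"
      using A B by (auto simp: col_space_eq[OF A] intro!: bexI[of _ "B *\<^sub>v x"])
  next
    fix y assume "y \<in> col_space A"
    then obtain x where x: "x \<in> carrier_vec n" "y \<in> carrier_vec nr" "A *\<^sub>v x = y"
      using A by (auto simp: col_space_eq[OF A])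
    have "(A * B) *\<^sub>v (B' *\<^sub>v x) = A *\<^sub>v (B *\<^sub>v (B' *\<^sub>v x))"
      using A B B' x(1) by (intro assoc_mult_mat_vec) auto
    also have "B *\<^sub>v (B' *\<^sub>v x) = (B * B') *\<^sub>v x"
      using B B' x(1) by (intro assoc_mult_mat_vec[symmetric]) auto
    finally have "(A * B) *\<^sub>v (B' *\<^sub>v x) = y" using x by (simp add: inv)
    then show "y \<in> col_space (A * B)"
      using A B B' x by (auto simp: col_space_eq[OF AB] intro!: bexI[of _ "B' *\<^sub>v x"])
  qed
  then show ?thesis by (simp add: rank_def col_space_def)
qed

section \<open>Composition of smooth maps\<close>

lemma is_chart_inj_on: "is_chart X n (D, \<theta>) \<Longrightarrow> inj_on \<theta> D"
  using openin_subset[of X D]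
  by (auto simp: is_chart_def homeomorphic_map_def quotient_map_def homeomorphic_eq_everything_map Int_absorb1)

lemma is_chart_image_open:
  assumes c: "is_chart X n (D, \<theta>)" and S: "openin X S" "S \<subseteq> D"
  shows "openin (Euclidean_space n) (\<theta> ` S)"
proof -
  have "open_map (subtopology X D) (subtopology (Euclidean_space n) (\<theta> ` D)) \<theta>"
    using c by (auto simp: is_chart_def intro: homeomorphic_imp_open_map)
  moreover have "openin (subtopology X D) S"
    using S by (auto simp: openin_subtopology)
  ultimately show ?thesis
    using c by (auto simp: is_chart_def open_map_def intro: openin_trans_full)
qed

lemma atlas_is_chart: "smooth_manifold M \<Longrightarrow> c \<in> atlas M \<Longrightarrow> is_chart (mtop M) (mdim M) c"
  by (auto simp: smooth_manifold_def)

lemma atlas_chart_subset: "smooth_manifold M \<Longrightarrow> (D, \<theta>) \<in> atlas M \<Longrightarrow> D \<subseteq> pts M"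
  using atlas_is_chart[of M "(D, \<theta>)"] openin_subset[of "mtop M" D] by (simp add: is_chart_def)

lemma smooth_manifold_chart_at:
  assumes "smooth_manifold M" "p \<in> pts M"
  obtains D \<theta> where "(D, \<theta>) \<in> atlas M" "p \<in> D"
proof -
  have "p \<in> \<Union>(fst ` atlas M)" using assms by (simp add: smooth_manifold_def)
  then show thesis using that by auto
qed

lemma inv_into_atlas_chart [simp]:
  "smooth_manifold M \<Longrightarrow> (D, \<theta>) \<in> atlas M \<Longrightarrow> p \<in> D \<Longrightarrow> inv_into D \<theta> (\<theta> p) = p"
  by (rule inv_into_f_f[OF is_chart_inj_on[OF atlas_is_chart]])

lemma smooth_mapD:
  "smooth_map M N F \<Longrightarrow> (D, \<theta>) \<in> atlas M \<Longrightarrow> (E, \<psi>) \<in> atlas N \<Longrightarrow>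
    smooth_euclid (mdim M) (mdim N) (\<theta> ` {p \<in> D. F p \<in> E}) (local_rep (D, \<theta>) (E, \<psi>) F)"
  by (auto simp: smooth_map_def)

lemma openin_smooth_map_preimage:
  assumes "smooth_manifold M" "smooth_map M N F" "(D, \<theta>) \<in> atlas M" "openin (mtop N) E"
  shows "openin (mtop M) {p \<in> D. F p \<in> E}"
proof -
  have "openin (mtop M) {p \<in> pts M. F p \<in> E}"
    using assms openin_continuous_map_preimage by (auto simp: smooth_map_def)
  moreover have "openin (mtop M) D"
    using atlas_is_chart[OF assms(1,3)] by (simp add: is_chart_def)
  ultimately have "openin (mtop M) (D \<inter> {p \<in> pts M. F p \<in> E})" by blast
  moreover have "D \<inter> {p \<in> pts M. F p \<in> E} = {p \<in> D. F p \<in> E}"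
    using atlas_chart_subset[OF assms(1,3)] by auto
  ultimately show ?thesis by simp
qed

text \<open>\<open>V\<close> is the part of the chart on \<open>D\<close> where the composite passes
  through \<open>D'\<close> into \<open>E\<close>. The first five conclusions are the premises
  shared by \<open>smooth_euclid_compose\<close> and \<open>jacobian_compose\<close>; the last
  carries their results over to the composite map.\<close>

lemma local_rep_compose:
  assumes M: "smooth_manifold M" and N: "smooth_manifold N" and P: "smooth_manifold P"
    and F: "smooth_map M N F" and G: "smooth_map N P G"
    and c: "(D, \<theta>) \<in> atlas M" and d: "(D', \<theta>') \<in> atlas N" and e: "(E, \<psi>) \<in> atlas P"
  defines "V \<equiv> \<theta> ` {p \<in> D. F p \<in> D' \<and> G (F p) \<in> E}" and "W \<equiv> \<theta>' ` {q \<in> D'. G q \<in> E}"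
  shows "openin (Euclidean_space (mdim M)) V" "openin (Euclidean_space (mdim N)) W"
    "smooth_euclid (mdim M) (mdim N) V (local_rep (D, \<theta>) (D', \<theta>') F)"
    "local_rep (D, \<theta>) (D', \<theta>') F ` V \<subseteq> W"
    "smooth_euclid (mdim N) (mdim P) W (local_rep (D', \<theta>') (E, \<psi>) G)"
    "x \<in> V \<Longrightarrow> local_rep (D, \<theta>) (E, \<psi>) (compose (pts M) G F) x =
      local_rep (D', \<theta>') (E, \<psi>) G (local_rep (D, \<theta>) (D', \<theta>') F x)"
proof -
  have E: "openin (mtop P) E" and D': "openin (mtop N) D'"
    using atlas_is_chart[OF P e] atlas_is_chart[OF N d] by (simp_all add: is_chart_def)
  have W': "openin (mtop N) {q \<in> D'. G q \<in> E}"
    by (rule openin_smooth_map_preimage[OF N G d E])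
  then show "openin (Euclidean_space (mdim N)) W"
    unfolding W_def by (intro is_chart_image_open[OF atlas_is_chart[OF N d]]) auto
  have "openin (mtop M) {p \<in> D. F p \<in> {q \<in> D'. G q \<in> E}}"
    by (rule openin_smooth_map_preimage[OF M F c W'])
  then show V: "openin (Euclidean_space (mdim M)) V"
    unfolding V_def by (intro is_chart_image_open[OF atlas_is_chart[OF M c]]) auto
  have "openin (Euclidean_space (mdim M)) (\<theta> ` {p \<in> D. F p \<in> D'})"
    by (intro is_chart_image_open[OF atlas_is_chart[OF M c]] openin_smooth_map_preimage[OF M F c D'])
      auto
  moreover have "V \<subseteq> \<theta> ` {p \<in> D. F p \<in> D'}" by (auto simp: V_def)
  ultimately show "smooth_euclid (mdim M) (mdim N) V (local_rep (D, \<theta>) (D', \<theta>') F)"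
    using smooth_mapD[OF F c d] C_k_subset V by (fastforce simp: smooth_euclid_def)
  show "local_rep (D, \<theta>) (D', \<theta>') F ` V \<subseteq> W"
    using M c by (auto simp: V_def W_def local_rep_def)
  show "smooth_euclid (mdim N) (mdim P) W (local_rep (D', \<theta>') (E, \<psi>) G)"
    unfolding W_def by (rule smooth_mapD[OF G d e])
  show "local_rep (D, \<theta>) (E, \<psi>) (compose (pts M) G F) x =
      local_rep (D', \<theta>') (E, \<psi>) G (local_rep (D, \<theta>) (D', \<theta>') F x)" if "x \<in> V"
    using that M N c d atlas_chart_subset[OF M c] by (auto simp: V_def local_rep_def compose_def)
qed

text \<open>Between two outer charts the composite may pass through several charts of
  \<open>N\<close>, so smoothness is checked near each point through a chart around its image under
  \<open>F\<close>.\<close>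

lemma smooth_map_compose:
  assumes M: "smooth_manifold M" and N: "smooth_manifold N" and P: "smooth_manifold P"
    and F: "smooth_map M N F" and G: "smooth_map N P G"
  shows "smooth_map M P (compose (pts M) G F)"
proof -
  have F': "F \<in> pts M \<rightarrow> pts N" and G': "G \<in> pts N \<rightarrow> pts P"
    using F G by (auto simp: smooth_map_def)
  have "continuous_map (mtop M) (mtop P) (G \<circ> F)"
    using F G by (auto simp: smooth_map_def intro: continuous_map_compose)
  then have cont: "continuous_map (mtop M) (mtop P) (compose (pts M) G F)"
    by (rule continuous_map_eq) (simp add: compose_eq)
  have "smooth_euclid (mdim M) (mdim P) (\<theta> ` {p \<in> D. compose (pts M) G F p \<in> E})
      (local_rep (D, \<theta>) (E, \<psi>) (compose (pts M) G F))"
    if c: "(D, \<theta>) \<in> atlas M" and e: "(E, \<psi>) \<in> atlas P" for D \<theta> E \<psi>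
  proof -
    let ?H = "local_rep (D, \<theta>) (E, \<psi>) (compose (pts M) G F)"
    \<comment> \<open>As a preimage under \<open>F\<close> of an open set of \<open>N\<close>, the
      domain is seen to be open.\<close>
    have eq: "{p \<in> D. compose (pts M) G F p \<in> E} = {p \<in> D. F p \<in> {q \<in> pts N. G q \<in> E}}"
      using atlas_chart_subset[OF M c] F' by (auto simp: compose_def)
    have "openin (mtop P) E" using atlas_is_chart[OF P e] by (simp add: is_chart_def)
    then have "openin (mtop N) {q \<in> pts N. G q \<in> E}"
      using G openin_continuous_map_preimage by (auto simp: smooth_map_def)
    then have V: "openin (Euclidean_space (mdim M)) (\<theta> ` {p \<in> D. compose (pts M) G F p \<in> E})"
      unfolding eq
      by (intro is_chart_image_open[OF atlas_is_chart[OF M c]] openin_smooth_map_preimage[OF M F c])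
        auto
    have "C_k (mdim M) (\<theta> ` {p \<in> D. compose (pts M) G F p \<in> E}) k (\<lambda>x. ?H x j)"
      if j: "j < mdim P" for j k
    proof (rule C_k_local[OF V])
      fix x assume "x \<in> \<theta> ` {p \<in> D. compose (pts M) G F p \<in> E}"
      then obtain p where p: "p \<in> D" "F p \<in> pts N" "G (F p) \<in> E" "x = \<theta> p"
        unfolding eq by auto
      obtain D' \<theta>' where d: "(D', \<theta>') \<in> atlas N" "F p \<in> D'"
        using smooth_manifold_chart_at[OF N p(2)] by blast
      define V' where "V' = \<theta> ` {p \<in> D. F p \<in> D' \<and> G (F p) \<in> E}"
      note * = local_rep_compose[OF M N P F G c d(1) e, folded V'_def]
      have "smooth_euclid (mdim M) (mdim P) V'
          (\<lambda>x. local_rep (D', \<theta>') (E, \<psi>) G (local_rep (D, \<theta>) (D', \<theta>') F x))"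
        by (rule smooth_euclid_compose[OF *(1-5)])
      then have "C_k (mdim M) V' k
          (\<lambda>x. local_rep (D', \<theta>') (E, \<psi>) G (local_rep (D, \<theta>) (D', \<theta>') F x) j)"
        using j by (simp add: smooth_euclid_def)
      then have "C_k (mdim M) V' k (\<lambda>x. ?H x j)"
        by (rule C_k_cong[OF *(1), rotated]) (simp add: *(6))
      moreover have "x \<in> V'" using p d by (auto simp: V'_def)
      moreover have "V' \<subseteq> \<theta> ` {p \<in> D. compose (pts M) G F p \<in> E}"
        unfolding eq using atlas_chart_subset[OF N d(1)] by (auto simp: V'_def)
      ultimately show "\<exists>V. openin (Euclidean_space (mdim M)) V \<and> x \<in> V \<and>
          V \<subseteq> \<theta> ` {p \<in> D. compose (pts M) G F p \<in> E} \<and> C_k (mdim M) V k (\<lambda>x. ?H x j)"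
        using *(1) by blast
    qed
    then show ?thesis by (simp add: smooth_euclid_def)
  qed
  moreover have "compose (pts M) G F \<in> pts M \<rightarrow>\<^sub>E pts P"
    using F' G' by (auto simp: compose_def)
  ultimately show ?thesis
    using cont by (auto simp: smooth_map_def)
qed

lemma jacobian_local_rep_compose:
  assumes M: "smooth_manifold M" and N: "smooth_manifold N" and P: "smooth_manifold P"
    and F: "smooth_map M N F" and G: "smooth_map N P G"
    and c: "(D, \<theta>) \<in> atlas M" and d: "(D', \<theta>') \<in> atlas N" and e: "(E, \<psi>) \<in> atlas P"
    and p: "p \<in> D" "F p \<in> D'" "G (F p) \<in> E"
  shows "jacobian (mdim M) (mdim P) (local_rep (D, \<theta>) (E, \<psi>) (compose (pts M) G F)) (\<theta> p) =
    jacobian (mdim N) (mdim P) (local_rep (D', \<theta>') (E, \<psi>) G) (\<theta>' (F p)) *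
    jacobian (mdim M) (mdim N) (local_rep (D, \<theta>) (D', \<theta>') F) (\<theta> p)"
proof -
  define V where "V = \<theta> ` {p \<in> D. F p \<in> D' \<and> G (F p) \<in> E}"
  note * = local_rep_compose[OF M N P F G c d e, folded V_def]
  have x: "\<theta> p \<in> V" using p by (auto simp: V_def)
  have "local_rep (D, \<theta>) (D', \<theta>') F (\<theta> p) = \<theta>' (F p)"
    using M c p by (simp add: local_rep_def)
  then show ?thesis
    using jacobian_compose[OF *(1-5) x] jacobian_cong[OF *(1) x *(6)] by simp
qed

text \<open>With the same chart on both sides the representative is the identity, though only on the
  image of \<open>D\<close>; as this image is open, the Jacobian does not see the
  difference.\<close>

lemma jacobian_local_rep_id:
  assumes M: "smooth_manifold M" and c: "(D, \<theta>) \<in> atlas M" and p: "p \<in> D"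
    and F: "\<And>q. q \<in> D \<Longrightarrow> F q = q"
  shows "jacobian (mdim M) (mdim M) (local_rep (D, \<theta>) (D, \<theta>) F) (\<theta> p) = 1\<^sub>m (mdim M)"
proof -
  have "openin (Euclidean_space (mdim M)) (\<theta> ` D)"
    using atlas_is_chart[OF M c] by (simp add: is_chart_def)
  then have "jacobian (mdim M) (mdim M) (local_rep (D, \<theta>) (D, \<theta>) F) (\<theta> p) =
      jacobian (mdim M) (mdim M) (\<lambda>x. x) (\<theta> p)"
    by (rule jacobian_cong) (use M c p F in \<open>auto simp: local_rep_def\<close>)
  then show ?thesis by (simp add: jacobian_id)
qed

section \<open>Constant rank under diffeomorphisms\<close>

lemma constant_rank_iff:
  "constant_rank M N F \<longleftrightarrow>
     (\<exists>r. \<forall>p\<in>pts M. \<forall>D \<theta> E \<psi>. (D, \<theta>) \<in> atlas M \<longrightarrow> (E, \<psi>) \<in> atlas N \<longrightarrow> p \<in> D \<longrightarrow> F p \<in> E \<longrightarrow>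
        vec_space.rank (mdim N)
          (jacobian (mdim M) (mdim N) (local_rep (D, \<theta>) (E, \<psi>) F) (\<theta> p)) = r)"
  by (simp add: constant_rank_def Ball_def split_paired_all imp_conjL)

text \<open>The Jacobian of f^-1 at \<open>f p\<close> is a right inverse of that of
  \<open>f\<close> at \<open>p\<close>, so the rank of the composite at \<open>p\<close> is the rank
  of \<open>G\<close> at \<open>f p\<close>. The constant \<open>r\<close> of \<open>G\<close> is
  thus also the constant of the composite.\<close>

lemma constant_rank_compose_diffeomorphism:
  assumes M: "smooth_manifold M" and N: "smooth_manifold N" and P: "smooth_manifold P"
    and f: "diffeomorphism M N f" and G: "smooth_map N P G" "constant_rank N P G"
  shows "constant_rank M P (compose (pts M) G f)"
proof -
  define g where "g = restrict (inv_into (pts M) f) (pts N)"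
  have fs: "smooth_map M N f" and gs: "smooth_map N M g" and bij: "bij_betw f (pts M) (pts N)"
    using f by (auto simp: diffeomorphism_def g_def)
  have gf: "g (f p) = p" if "p \<in> pts M" for p
    using bij that by (auto simp: g_def bij_betw_def)
  have fg: "f (g q) = q" if "q \<in> pts N" for q
    using bij that by (auto simp: g_def bij_betw_def f_inv_into_f)
  obtain r where r: "\<And>q D' \<theta>' E \<psi>. q \<in> pts N \<Longrightarrow> (D', \<theta>') \<in> atlas N \<Longrightarrow> (E, \<psi>) \<in> atlas P \<Longrightarrow>
      q \<in> D' \<Longrightarrow> G q \<in> E \<Longrightarrow> vec_space.rank (mdim P)
        (jacobian (mdim N) (mdim P) (local_rep (D', \<theta>') (E, \<psi>) G) (\<theta>' q)) = r"
    using G(2) unfolding constant_rank_iff by metis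
  have "vec_space.rank (mdim P) (jacobian (mdim M) (mdim P)
      (local_rep (D, \<theta>) (E, \<psi>) (compose (pts M) G f)) (\<theta> p)) = r"
    if p: "p \<in> pts M" "p \<in> D" "compose (pts M) G f p \<in> E"
      and c: "(D, \<theta>) \<in> atlas M" and e: "(E, \<psi>) \<in> atlas P" for p D \<theta> E \<psi>
  proof -
    have q: "f p \<in> pts N" "G (f p) \<in> E"
      using p bij by (auto simp: compose_def bij_betw_def)
    obtain D' \<theta>' where d: "(D', \<theta>') \<in> atlas N" "f p \<in> D'"
      using smooth_manifold_chart_at[OF N q(1)] by blast
    \<comment> \<open>The chain rule for f o g, based at \<open>f p\<close> in \<open>N\<close>,
      with \<open>D\<close> as the middle chart and \<open>D'\<close> at both ends.\<close>
    have "jacobian (mdim M) (mdim N) (local_rep (D, \<theta>) (D', \<theta>') f) (\<theta> (g (f p))) *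
        jacobian (mdim N) (mdim M) (local_rep (D', \<theta>') (D, \<theta>) g) (\<theta>' (f p)) =
        jacobian (mdim N) (mdim N) (local_rep (D', \<theta>') (D', \<theta>') (compose (pts N) f g)) (\<theta>' (f p))"
      using p q d gf
      by (intro jacobian_local_rep_compose[OF N M N gs fs d(1) c d(1), symmetric]) auto
    also have "\<dots> = 1\<^sub>m (mdim N)"
      using atlas_chart_subset[OF N d(1)] fg
      by (intro jacobian_local_rep_id[OF N d]) (auto simp: compose_def)
    finally have "jacobian (mdim M) (mdim N) (local_rep (D, \<theta>) (D', \<theta>') f) (\<theta> p) *
        jacobian (mdim N) (mdim M) (local_rep (D', \<theta>') (D, \<theta>) g) (\<theta>' (f p)) = 1\<^sub>m (mdim N)"
      using gf[OF p(1)] by simp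
    from rank_mult_right_invertible[OF jacobian_carrier jacobian_carrier jacobian_carrier this]
    show ?thesis
      using jacobian_local_rep_compose[OF M N P fs G(1) c d(1) e p(2) d(2) q(2)]
        r[OF q(1) d(1) e d(2) q(2)] by simp
  qed
  then show ?thesis by (auto simp: constant_rank_iff intro!: exI[of _ r])
qed

lemma diffeomorphism_inverse:
  assumes f: "diffeomorphism M N f"
  shows "diffeomorphism N M (restrict (inv_into (pts M) f) (pts N))" (is "diffeomorphism N M ?g")
proof -
  have bij: "bij_betw f (pts M) (pts N)" and fs: "smooth_map M N f"
    using f by (auto simp: diffeomorphism_def)
  have g: "bij_betw ?g (pts N) (pts M)"
    using bij_betw_inv_into[OF bij] by (simp cong: bij_betw_cong)
  have "inv_into (pts N) ?g p = f p" if p: "p \<in> pts M" for p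
  proof (rule inv_into_f_eq)
    show "inj_on ?g (pts N)" using g by (simp add: bij_betw_def)
    show "f p \<in> pts N" using bij p by (auto simp: bij_betw_def)
    then show "?g (f p) = p" using bij p by (auto simp: bij_betw_def)
  qed
  \<comment> \<open>The inverse of the inverse is equal to \<open>f\<close> as a function, not just
    on points, because smooth maps are extensional.\<close>
  then have "restrict (inv_into (pts N) ?g) (pts M) = f"
    using fs by (auto simp: smooth_map_def fun_eq_iff PiE_def extensional_def)
  then show ?thesis using f g fs by (simp add: diffeomorphism_def)
qed

section \<open>The forgetful functors\<close>

lemma surj_on_objects_forget:
  fixes M :: "'m mfd" and N :: "'n mfd"
  assumes M: "smooth_manifold M"
    and u1: "smooth_map M N u1" and f: "diffeomorphism M M f" and u2: "u2 = compose (pts M) u1 f"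
  shows "surj_on_objects (forget1 TYPE('c) M M N u1 u2)"
    "surj_on_objects (forget2 TYPE('c) M M N u1 u2)"
proof -
  \<comment> \<open>This serves both functors: \<open>g\<close> is \<open>f\<close> for the first
    and the inverse of \<open>f\<close> for the second.\<close>
  have pull: "smooth_map M C (compose (pts M) \<phi> g) \<and> constant_rank M C (compose (pts M) \<phi> g) \<and>
      compose (pts M) U (compose (pts M) \<phi> g) = compose (pts M) u g"
    if "constant_rank_factorization M N u C \<phi> U" "diffeomorphism M M g"
    for C :: "'c mfd" and u \<phi> U g
  proof -
    have C: "smooth_manifold C" "smooth_map M C \<phi>" "constant_rank M C \<phi>" "u = compose (pts M) U \<phi>"
      and g: "smooth_map M M g"
      using that by (auto simp: constant_rank_factorization_def diffeomorphism_def)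
    have "g \<in> pts M \<rightarrow> pts M" using g by (auto simp: smooth_map_def)
    then show ?thesis
      using smooth_map_compose[OF M M C(1) g C(2)]
        constant_rank_compose_diffeomorphism[OF M M C(1) that(2) C(2,3)]
      by (auto simp: C(4) compose_def fun_eq_iff)
  qed
  show "surj_on_objects (forget1 TYPE('c) M M N u1 u2)"
    unfolding surj_on_objects_def
  proof
    fix Y assume "Y \<in> Obj (tgt (forget1 TYPE('c) M M N u1 u2))"
    then obtain C \<phi> U where Y: "Y = (C, \<phi>, U)" "constant_rank_factorization M N u1 C \<phi> U"
      by (auto simp: forget1_def Const_def)
    then show "\<exists>X\<in>Obj (src (forget1 TYPE('c) M M N u1 u2)).
        on_obj (forget1 TYPE('c) M M N u1 u2) X = Y"
      using pull[OF Y(2) f] u2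
      by (intro bexI[of _ "(C, \<phi>, compose (pts M) \<phi> f, U)"])
        (auto simp: forget1_def CRSE_def constant_rank_factorization_def)
  qed
  show "surj_on_objects (forget2 TYPE('c) M M N u1 u2)"
    unfolding surj_on_objects_def
  proof
    fix Y assume "Y \<in> Obj (tgt (forget2 TYPE('c) M M N u1 u2))"
    then obtain C \<phi> U where Y: "Y = (C, \<phi>, U)" "constant_rank_factorization M N u2 C \<phi> U"
      by (auto simp: forget2_def Const_def)
    define g where "g = restrict (inv_into (pts M) f) (pts M)"
    have bij: "bij_betw f (pts M) (pts M)" using f by (simp add: diffeomorphism_def)
    \<comment> \<open>Hence precomposition with \<open>g\<close> turns a factorization of
      \<open>u2\<close> into one of \<open>u1\<close> with the same \<open>U\<close>.\<close>
    have "compose (pts M) u2 g = u1"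
    proof (rule extensionalityI)
      show "u1 \<in> extensional (pts M)" using u1 by (simp add: smooth_map_def PiE_iff)
      show "compose (pts M) u2 g p = u1 p" if "p \<in> pts M" for p
        using that bij bij_betw_inv_into_right[OF bij that]
        by (simp add: u2 compose_def g_def bij_betw_def inv_into_into)
    qed simp
    moreover have "diffeomorphism M M g"
      unfolding g_def by (rule diffeomorphism_inverse[OF f])
    ultimately show "\<exists>X\<in>Obj (src (forget2 TYPE('c) M M N u1 u2)).
        on_obj (forget2 TYPE('c) M M N u1 u2) X = Y"
      using pull[OF Y(2), of g] Y
      by (intro bexI[of _ "(C, compose (pts M) \<phi> g, \<phi>, U)"])
        (auto simp: forget2_def CRSE_def constant_rank_factorization_def)
  qed
qed

section \<open>Zero-dimensional manifolds and the failure of fullness\<close>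

definition discrete_mfd :: "'a set \<Rightarrow> 'a mfd" where
  "discrete_mfd S = \<lparr>mtop = discrete_topology S, mdim = 0,
     atlas = {c. is_chart (discrete_topology S) 0 c}\<rparr>"

lemma smooth_euclid_0 [simp]: "smooth_euclid n 0 W G"
  by (simp add: smooth_euclid_def)

lemma is_chart_discrete_singleton:
  assumes "p \<in> S"
  shows "is_chart (discrete_topology S) 0 ({p}, \<lambda>x\<in>{p}. \<lambda>i. 0)"
proof -
  have "topspace (Euclidean_space 0) = {\<lambda>i. 0}"
    by (auto simp: topspace_Euclidean_space)
  then have "openin (Euclidean_space 0) {\<lambda>i. 0}"
    by (metis openin_topspace)
  moreover have "homeomorphic_map (subtopology (discrete_topology S) {p})
      (subtopology (Euclidean_space 0) {\<lambda>i. 0}) (\<lambda>x\<in>{p}. \<lambda>i. 0)"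
    using assms
    by (auto simp: homeomorphic_map_maps homeomorphic_maps_def topspace_Euclidean_space
        intro!: exI[of _ "\<lambda>x. p"])
  ultimately show ?thesis using assms by (simp add: is_chart_def)
qed

lemma smooth_manifold_discrete_mfd:
  assumes "countable S"
  shows "smooth_manifold (discrete_mfd S)"
proof -
  have "\<Union>(fst ` {c. is_chart (discrete_topology S) 0 c}) = S"
  proof (intro equalityI subsetI)
    fix p assume "p \<in> S"
    then show "p \<in> \<Union>(fst ` {c. is_chart (discrete_topology S) 0 c})"
      using is_chart_discrete_singleton[of p S]
      by (auto intro!: bexI[of _ "({p}, \<lambda>x\<in>{p}. \<lambda>i. 0)"])
  next
    fix p assume "p \<in> \<Union>(fst ` {c. is_chart (discrete_topology S) 0 c})"
    then show "p \<in> S" by (auto simp: is_chart_def)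
  qed
  \<comment> \<open>Compatibility quantifies over coordinates below 0, so the maximal atlas consists
    of all charts.\<close>
  moreover have "compatible 0 c d" for c d :: "'a chart"
    by (simp add: compatible_def split_beta)
  ultimately show ?thesis
    using assms by (simp add: smooth_manifold_def discrete_mfd_def
        second_countable_discrete_topology Hausdorff_space_discrete_topology)
qed

text \<open>A discrete domain makes every map continuous, and a target of dimension 0 makes the
  condition on derivatives vacuous.\<close>

lemma smooth_map_discrete_mfd:
  "F \<in> S \<rightarrow>\<^sub>E T \<Longrightarrow> smooth_map (discrete_mfd S) (discrete_mfd T) F"
  by (simp add: smooth_map_def discrete_mfd_def split_beta PiE_iff Pi_iff)

lemma constant_rank_discrete_mfd:
  "constant_rank (discrete_mfd S) (discrete_mfd T) F"
proof -
  \<comment> \<open>All 0 by 0 matrices are equal, so their common rank need not be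
    computed.\<close>
  have "jacobian 0 0 G x = jacobian 0 0 H y" for G H x y
    by (rule eq_matI) (simp_all add: jacobian_def)
  then have "\<exists>r. \<forall>G x. vec_space.rank 0 (jacobian 0 0 G x) = r" by metis
  then show ?thesis
    by (auto simp: constant_rank_iff discrete_mfd_def)
qed

text \<open>The last component of \<open>X\<close> is constant, so every self-map of
  \<open>C\<close> respects it and only the two maps out of the point impose conditions. The
  functors leave morphisms unchanged, so the only candidate for a lift of \<open>?k\<close> is
  \<open>?k\<close> itself; \<open>X\<close> acts as both source and target.\<close>

lemma forget_not_full:
  fixes M :: "real mfd" and u :: "real \<Rightarrow> real"
  defines "M \<equiv> discrete_mfd {0}" and "u \<equiv> (\<lambda>x\<in>{0}. 0)"
  shows "\<not> surj_on_morphisms (forget1 TYPE(real) M M M u u)"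
    "\<not> surj_on_morphisms (forget2 TYPE(real) M M M u u)"
proof -
  define C :: "real mfd" where "C = discrete_mfd {0, 1}"
  define X where "X = (C, \<lambda>x\<in>{0::real}. 0::real, \<lambda>x\<in>{0::real}. 1::real, \<lambda>c\<in>{0,1::real}. 0::real)"
  have pts: "pts M = {0}" "pts C = {0, 1}" by (simp_all add: M_def C_def discrete_mfd_def)
  have smooth: "smooth_map M C F" if "F \<in> {0} \<rightarrow>\<^sub>E {0,1}" for F
    using that unfolding M_def C_def by (rule smooth_map_discrete_mfd)
  have smooth': "smooth_map C C F" if "F \<in> {0,1} \<rightarrow>\<^sub>E {0,1}" for F
    using that unfolding C_def by (rule smooth_map_discrete_mfd)
  have "smooth_map C M (\<lambda>c\<in>{0,1}. 0)"
    unfolding M_def C_def by (rule smooth_map_discrete_mfd) auto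
  then have X: "X \<in> Obj (CRSE TYPE(real) M M M u u)"
    using smooth_manifold_discrete_mfd[of "{0,1::real}"]
      constant_rank_discrete_mfd[of "{0::real}" "{0,1::real}"]
    by (auto simp: X_def CRSE_def pts smooth compose_def u_def fun_eq_iff simp flip: C_def M_def)
  show "\<not> surj_on_morphisms (forget1 TYPE(real) M M M u u)"
  proof
    \<comment> \<open>It fixes 0, the value of the first map, but moves 1, the value of the
      second.\<close>
    let ?k = "\<lambda>c\<in>{0,1::real}. 0::real"
    assume "surj_on_morphisms (forget1 TYPE(real) M M M u u)"
    moreover have "?k \<in> Hom (Const TYPE(real) M M u) (C, \<lambda>x\<in>{0}. 0, \<lambda>c\<in>{0,1}. 0)
        (C, \<lambda>x\<in>{0}. 0, \<lambda>c\<in>{0,1}. 0)"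
      by (auto simp: Const_def smooth' pts compose_def fun_eq_iff)
    ultimately have "?k \<in> Hom (CRSE TYPE(real) M M M u u) X X"
      using X unfolding surj_on_morphisms_def by (force simp: forget1_def X_def)
    then have "(\<lambda>x\<in>{0::real}. 1::real) = compose {0} ?k (\<lambda>x\<in>{0}. 1)"
      by (auto simp: CRSE_def X_def pts)
    from fun_cong[OF this, of 0] show False by (simp add: compose_def)
  qed
  show "\<not> surj_on_morphisms (forget2 TYPE(real) M M M u u)"
  proof
    \<comment> \<open>Now 1 is fixed and 0 is moved.\<close>
    let ?k = "\<lambda>c\<in>{0,1::real}. 1::real"
    assume "surj_on_morphisms (forget2 TYPE(real) M M M u u)"
    moreover have "?k \<in> Hom (Const TYPE(real) M M u) (C, \<lambda>x\<in>{0}. 1, \<lambda>c\<in>{0,1}. 0)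
        (C, \<lambda>x\<in>{0}. 1, \<lambda>c\<in>{0,1}. 0)"
      by (auto simp: Const_def smooth' pts compose_def fun_eq_iff)
    ultimately have "?k \<in> Hom (CRSE TYPE(real) M M M u u) X X"
      using X unfolding surj_on_morphisms_def by (force simp: forget2_def X_def)
    then have "(\<lambda>x\<in>{0::real}. 0::real) = compose {0} ?k (\<lambda>x\<in>{0}. 0)"
      by (auto simp: CRSE_def X_def pts)
    from fun_cong[OF this, of 0] show False by (simp add: compose_def)
  qed
qed

text \<open>The positive half is stated for arbitrary point types; the example lives over
  \<open>real\<close>, whose elements 0 and 1 are the points of its phase space.\<close>

theorem theorem4:
  shows "(\<forall>(M :: 'm mfd) (N :: 'n mfd) u1 u2 f.
            smooth_manifold M \<and> connected_space (mtop M) \<and> smooth_manifold N \<and>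
            smooth_map M N u1 \<and> smooth_map M N u2 \<and>
            diffeomorphism M M f \<and> u2 = compose (pts M) u1 f \<longrightarrow>
            surj_on_objects (forget1 TYPE('c) M M N u1 u2) \<and>
            surj_on_objects (forget2 TYPE('c) M M N u1 u2)) \<and>
         (\<exists>(M :: real mfd) (N :: real mfd) u1 u2 f.
            smooth_manifold M \<and> connected_space (mtop M) \<and> smooth_manifold N \<and>
            smooth_map M N u1 \<and> smooth_map M N u2 \<and>
            diffeomorphism M M f \<and> u2 = compose (pts M) u1 f \<and>
            \<not> surj_on_morphisms (forget1 TYPE(real) M M N u1 u2) \<and>
            \<not> surj_on_morphisms (forget2 TYPE(real) M M N u1 u2))"
proof (rule conjI)
  \<comment> \<open>On the one-point manifold \<open>?u\<close> is the identity; it serves as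
    \<open>u1\<close>, \<open>u2\<close> and \<open>f\<close> at once.\<close>
  let ?M = "discrete_mfd {0::real}" and ?u = "\<lambda>x\<in>{0::real}. 0::real"
  have pts: "pts ?M = {0}" by (simp add: discrete_mfd_def)
  have M: "smooth_manifold ?M" by (simp add: smooth_manifold_discrete_mfd)
  have u: "smooth_map ?M ?M ?u" by (rule smooth_map_discrete_mfd) auto
  have "connected_space (mtop ?M)"
    by (simp add: discrete_mfd_def connected_space_discrete_topology)
  moreover have "diffeomorphism ?M ?M ?u"
  proof -
    have "inv_into {0} ?u 0 = 0" using inv_into_into[of 0 ?u "{0}"] by simp
    then have "restrict (inv_into {0} ?u) {0} = ?u" by (auto simp: restrict_def)
    then show ?thesis by (simp add: diffeomorphism_def pts u bij_betw_def)
  qed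
  moreover have "?u = compose (pts ?M) ?u ?u" by (auto simp: pts compose_def)
  ultimately show "\<exists>(M :: real mfd) (N :: real mfd) u1 u2 f.
            smooth_manifold M \<and> connected_space (mtop M) \<and> smooth_manifold N \<and>
            smooth_map M N u1 \<and> smooth_map M N u2 \<and>
            diffeomorphism M M f \<and> u2 = compose (pts M) u1 f \<and>
            \<not> surj_on_morphisms (forget1 TYPE(real) M M N u1 u2) \<and>
            \<not> surj_on_morphisms (forget2 TYPE(real) M M N u1 u2)"
    using M u forget_not_full by blast
qed (use surj_on_objects_forget in blast)

end
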